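(* Let $(I,\leq)$ be a linearly ordered set and let $\Gamma$ be a subgroup of $\mathrm{B}(I,\leq)$ which is proximal on $(I,\leq)$, i.e. for every $a<b$ and $c<d$ in $I$ there exists $g\in\Gamma$ such that $g(a)<c<d<g(b)$. Then the commutator subgroup $\Gamma'=[\Gamma,\Gamma]$ is $6$-uniformly simple, and the commutator width of $\Gamma'$ is at most two.
   Context: $\mathrm{Aut}(I,\leq)$ is the group of order preserving bijections of $I$. An element $g\in\mathrm{Aut}(I,\leq)$ is boundedly supported if there are $a,b\in I$ such that $g(x)\neq x$ only if $a<x<b$; $\mathrm{B}(I,\leq)$ is the subgroup of boundedly supported elements of $\mathrm{Aut}(I,\leq)$. A group $G$ is called $N$-uniformly simple if for every nontrivial $f\in G$ and every nontrivial conjugacy class $C\subset G$, the element $f$ is a product of at most $N$ elements of $C^{\pm1}=C\cup C^{-1}$. The commutator length of an element of $[G,G]$ is the minimal number of commutators of elements of $G$ whose product it is; the commutator width of $G$ is the maximum of the commutator lengths of the elements of $[G,G]$. *)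

theory Defs
  imports "HOL-Algebra.Generated_Groups" "HOL-Library.Extended_Nat"
begin

definition order_aut :: "('a::linorder \<Rightarrow> 'a) monoid"
  where "order_aut = \<lparr> carrier = {f. bij f \<and> mono f}, mult = (\<circ>), one = id \<rparr>"

definition boundedly_supported :: "('a::linorder \<Rightarrow> 'a) \<Rightarrow> bool"
  where "boundedly_supported g \<longleftrightarrow> (\<exists>a b. \<forall>x. g x \<noteq> x \<longrightarrow> a < x \<and> x < b)"

definition bounded_order_aut :: "('a::linorder \<Rightarrow> 'a) monoid"
  where "bounded_order_aut =
    order_aut \<lparr> carrier := {g \<in> carrier order_aut. boundedly_supported g} \<rparr>"

definition proximal :: "('a::linorder \<Rightarrow> 'a) set \<Rightarrow> bool"
  where "proximal \<Gamma> \<longleftrightarrow>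
    (\<forall>a b c d. a < b \<longrightarrow> c < d \<longrightarrow> (\<exists>g\<in>\<Gamma>. g a < c \<and> c < d \<and> d < g b))"

definition commutator_subgroup :: "('g, 'm) monoid_scheme \<Rightarrow> ('g, 'm) monoid_scheme"
  where "commutator_subgroup G = G \<lparr> carrier := derived G (carrier G) \<rparr>"

definition conj_class :: "('g, 'm) monoid_scheme \<Rightarrow> 'g \<Rightarrow> 'g set"
  where "conj_class G c = {x \<otimes>\<^bsub>G\<^esub> c \<otimes>\<^bsub>G\<^esub> inv\<^bsub>G\<^esub> x | x. x \<in> carrier G}"

definition is_product :: "('g, 'm) monoid_scheme \<Rightarrow> 'g set \<Rightarrow> nat \<Rightarrow> 'g \<Rightarrow> bool"
  where "is_product G S n f \<longleftrightarrow>
    (\<exists>xs. length xs = n \<and> set xs \<subseteq> S \<and> foldr (\<otimes>\<^bsub>G\<^esub>) xs \<one>\<^bsub>G\<^esub> = f)"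

definition uniformly_simple :: "nat \<Rightarrow> ('g, 'm) monoid_scheme \<Rightarrow> bool"
  where "uniformly_simple N G \<longleftrightarrow> group G \<and>
    (\<forall>f \<in> carrier G - {\<one>\<^bsub>G\<^esub>}. \<forall>c \<in> carrier G - {\<one>\<^bsub>G\<^esub>}.
       \<exists>n\<le>N. is_product G (conj_class G c \<union> m_inv G ` conj_class G c) n f)"

text \<open>Both quantities are extended naturals, so that the length of a non-product and an
  unbounded width are \<open>\<infinity>\<close> rather than an arbitrary number. A finite supremum of extended
  naturals is attained, so the width is a maximum whenever it is finite.\<close>

definition commutator_length :: "('g, 'm) monoid_scheme \<Rightarrow> 'g \<Rightarrow> enat"
  where "commutator_length G f = (INF n\<in>{n. is_product G (derived_set G (carrier G)) n f}. enat n)"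

definition commutator_width :: "('g, 'm) monoid_scheme \<Rightarrow> enat"
  where "commutator_width G = (SUP f\<in>derived G (carrier G). commutator_length G f)"

end

theory Submission
  imports Defs
begin

text \<open>
  An element of a boundedly supported group moves only points between some \<open>p\<close> and \<open>q\<close>. If \<open>h\<close>
  satisfies \<open>q \<le> h p\<close>, then conjugation by \<open>h\<close> displaces such elements: they commute with every
  conjugate by \<open>h\<close> of an element that is the identity below \<open>p\<close>. By proximality every nontrivial
  conjugacy class or its inverse contains such an \<open>h\<close>.

  Moving the factors of a product \<open>x\<close> of commutators to disjoint places by powers of \<open>h\<close> makes
  them commute, so that they merge into one commutator \<open>[a, b]\<close>, and the cost of moving them is a
  single commutator: \<open>x = [a, b] [y, h]\<close>. Moreover \<open>[a, b] = [[a, k], b]\<close> whenever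
  \<open>k a\<^sup>-\<^sup>1 k\<^sup>-\<^sup>1\<close> commutes with \<open>b\<close>, which is a product of four conjugates of \<open>k\<close> and its inverse;
  together with the two conjugates in \<open>[y, h]\<close> this gives six.

  The same identity gives \<open>[u, v] = [[u, k], [v, k']]\<close>, so the commutator subgroup of \<open>\<Gamma>\<close> is
  perfect. It is proximal because \<open>s\<close> and \<open>[s, t]\<close> agree at given points once \<open>t\<close> moves the
  support of \<open>s\<close> away from them, so the above applies to it.
\<close>

section \<open>Commutator identities in an abstract group\<close>

context group
begin

abbreviation commutator :: "'a \<Rightarrow> 'a \<Rightarrow> 'a"
  where "commutator a b \<equiv> a \<otimes> b \<otimes> inv a \<otimes> inv b"

lemma cancel_inv_left [simp]:
  assumes "x \<in> carrier G" "y \<in> carrier G"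
  shows "inv x \<otimes> (x \<otimes> y) = y" and "x \<otimes> (inv x \<otimes> y) = y"
  using assms by (simp_all flip: m_assoc)

lemma inv_commutator:
  assumes "a \<in> carrier G" "b \<in> carrier G"
  shows "inv (commutator a b) = commutator b a"
  using assms by (simp add: inv_mult_group m_assoc)

lemma conj_commutator:
  assumes "a \<in> carrier G" "b \<in> carrier G" "h \<in> carrier G"
  shows "h \<otimes> commutator a b \<otimes> inv h = commutator (h \<otimes> a \<otimes> inv h) (h \<otimes> b \<otimes> inv h)"
  using assms by (simp add: inv_mult_group m_assoc)

text \<open>Here \<open>e \<otimes> b \<otimes> inv e = b\<close>, so \<open>e\<close> cancels
  inside the commutator. With \<open>e = k \<otimes> inv a \<otimes> inv k\<close> the product
  \<open>a \<otimes> e\<close> is \<open>commutator a k\<close>, so an arbitrary entry may be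
  replaced by a commutator.\<close>

lemma commutator_mult_commuting:
  assumes "a \<in> carrier G" "b \<in> carrier G" "e \<in> carrier G" and "e \<otimes> b = b \<otimes> e"
  shows "commutator (a \<otimes> e) b = commutator a b"
proof -
  have "e \<otimes> (b \<otimes> inv e) = b"
    using assms by (simp add: m_assoc flip: inv_solve_right' m_assoc)
  then have "e \<otimes> (b \<otimes> (inv e \<otimes> z)) = b \<otimes> z" if "z \<in> carrier G" for z
    using assms that by (metis inv_closed m_assoc m_closed)
  then show ?thesis
    using assms by (simp add: inv_mult_group m_assoc)
qed

lemma commutes_mult:
  assumes "x \<in> carrier G" "y \<in> carrier G" "z \<in> carrier G"
    and "x \<otimes> y = y \<otimes> x" "x \<otimes> z = z \<otimes> x"
  shows "x \<otimes> (y \<otimes> z) = (y \<otimes> z) \<otimes> x"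
  using assms by (metis m_assoc)

lemma commutes_inv:
  assumes "x \<in> carrier G" "y \<in> carrier G" and "x \<otimes> y = y \<otimes> x"
  shows "x \<otimes> inv y = inv y \<otimes> x"
  using assms by (metis inv_closed inv_solve_left inv_solve_right m_assoc m_closed)

lemma mult_swap_middle:
  assumes "p \<in> carrier G" "u \<in> carrier G" "k \<in> carrier G" "w \<in> carrier G" and "u \<otimes> k = k \<otimes> u"
  shows "(p \<otimes> u) \<otimes> (k \<otimes> w) = (p \<otimes> k) \<otimes> (u \<otimes> w)"
  using assms by (metis m_assoc m_closed)

text \<open>Rewriting a product \<open>g \<otimes> h\<close> as
  \<open>commutator g h \<otimes> (h \<otimes> g)\<close> for both pairs gives
  \<open>(a \<otimes> b) \<otimes> (c \<otimes> d)\<close> as the two commutators followed by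
  \<open>(b \<otimes> a) \<otimes> (d \<otimes> c)\<close>. The latter equals
  \<open>(b \<otimes> d) \<otimes> (a \<otimes> c)\<close> and is divided off on the right.\<close>

lemma commutator_mult_distrib:
  assumes carr: "a \<in> carrier G" "b \<in> carrier G" "c \<in> carrier G" "d \<in> carrier G"
    and comm: "a \<otimes> c = c \<otimes> a" "a \<otimes> d = d \<otimes> a" "b \<otimes> c = c \<otimes> b" "b \<otimes> d = d \<otimes> b"
  shows "commutator (a \<otimes> c) (b \<otimes> d) = commutator a b \<otimes> commutator c d"
proof -
  have "(b \<otimes> a) \<otimes> c = c \<otimes> (b \<otimes> a)" "(b \<otimes> a) \<otimes> d = d \<otimes> (b \<otimes> a)"
    using commutes_mult[of c b a] commutes_mult[of d b a] carr comm by simp_all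
  then have ba: "(b \<otimes> a) \<otimes> commutator c d = commutator c d \<otimes> (b \<otimes> a)"
    using carr by (intro commutes_mult commutes_inv m_closed inv_closed)
  have "(a \<otimes> c) \<otimes> (b \<otimes> d) = (a \<otimes> b) \<otimes> (c \<otimes> d)"
    using carr comm by (intro mult_swap_middle) auto
  also have "\<dots> = (commutator a b \<otimes> (b \<otimes> a)) \<otimes> (commutator c d \<otimes> (d \<otimes> c))"
    using carr by (simp add: m_assoc)
  also have "\<dots> = (commutator a b \<otimes> commutator c d) \<otimes> ((b \<otimes> a) \<otimes> (d \<otimes> c))"
    using carr by (intro mult_swap_middle ba m_closed inv_closed)
  also have "(b \<otimes> a) \<otimes> (d \<otimes> c) = (b \<otimes> d) \<otimes> (a \<otimes> c)"
    using carr comm by (intro mult_swap_middle) auto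
  finally have "((a \<otimes> c) \<otimes> (b \<otimes> d)) \<otimes> inv ((b \<otimes> d) \<otimes> (a \<otimes> c)) = commutator a b \<otimes> commutator c d"
    using carr by (subst inv_solve_right') auto
  then show ?thesis
    using carr by (simp add: inv_mult_group m_assoc)
qed

text \<open>The induction step for collecting commutators: a new left factor \<open>c\<close> is
  absorbed into \<open>c'\<close>, at the price of one further conjugation by \<open>h\<close> and a
  new first entry in the single error commutator. With \<open>s\<close> and \<open>v\<close> as in
  the proof, that error commutator equals \<open>s \<otimes> inv v\<close>, and \<open>s\<close>
  commutes with \<open>v\<close>.\<close>

lemma mult_commutator_shift:
  assumes carr: "h \<in> carrier G" "c \<in> carrier G" "c' \<in> carrier G" "y' \<in> carrier G"
    and x': "x' = c' \<otimes> commutator y' h"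
    and comm: "(c \<otimes> x') \<otimes> (h \<otimes> (c \<otimes> c') \<otimes> inv h) = (h \<otimes> (c \<otimes> c') \<otimes> inv h) \<otimes> (c \<otimes> x')"
  shows "c \<otimes> x' = h \<otimes> (c \<otimes> c') \<otimes> inv h \<otimes> commutator (c \<otimes> x' \<otimes> (h \<otimes> y' \<otimes> inv h)) h"
proof -
  define s where "s = c \<otimes> x'"
  define v where "v = h \<otimes> (c \<otimes> c') \<otimes> inv h"
  have [simp]: "x' \<in> carrier G" "s \<in> carrier G" "v \<in> carrier G"
    using carr by (simp_all add: x' s_def v_def)
  have "commutator (s \<otimes> (h \<otimes> y' \<otimes> inv h)) h = s \<otimes> h \<otimes> commutator y' h \<otimes> inv s \<otimes> inv h"
    using carr by (simp add: inv_mult_group m_assoc)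
  also have "commutator y' h = inv c' \<otimes> x'"
    using carr by (simp add: x')
  also have "s \<otimes> h \<otimes> (inv c' \<otimes> x') \<otimes> inv s \<otimes> inv h = s \<otimes> inv v"
    using carr by (simp add: s_def v_def inv_mult_group m_assoc)
  also have "\<dots> = inv v \<otimes> s"
    using comm by (intro commutes_inv) (simp_all flip: s_def v_def)
  finally show ?thesis
    unfolding s_def[symmetric] v_def[symmetric] using carr by simp
qed

text \<open>\<open>H\<close> is where the factors of \<open>x\<close> live, and \<open>K\<close> has
  room for their copies moved by powers of \<open>h\<close>. Each new factor from \<open>H\<close>
  commutes with the earlier ones once these are conjugated by \<open>h\<close>, so they merge into
  one commutator of elements of \<open>K\<close>.\<close>

lemma displaced_generate_derived_set:
  assumes H: "subgroup H G" and K: "subgroup K G" and "H \<subseteq> K" and h: "h \<in> carrier G"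
    and conj: "\<And>k. k \<in> K \<Longrightarrow> h \<otimes> k \<otimes> inv h \<in> K"
    and comm: "\<And>x k. x \<in> H \<Longrightarrow> k \<in> K \<Longrightarrow> x \<otimes> (h \<otimes> k \<otimes> inv h) = (h \<otimes> k \<otimes> inv h) \<otimes> x"
    and x: "x \<in> generate G (derived_set G H)"
  shows "\<exists>a\<in>K. \<exists>b\<in>K. \<exists>y\<in>carrier G. x = h \<otimes> commutator a b \<otimes> inv h \<otimes> commutator y h"
proof -
  interpret H: subgroup H G by (rule H)
  interpret K: subgroup K G by (rule K)
  \<comment> \<open>Membership in \<open>H\<close> belongs to the invariant because the product
    collected so far must commute with the conjugates of elements of \<open>K\<close> by
    \<open>h\<close>.\<close>
  define Q where "Q z \<longleftrightarrow> z \<in> H \<and>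
    (\<exists>a\<in>K. \<exists>b\<in>K. \<exists>y\<in>carrier G. z = h \<otimes> commutator a b \<otimes> inv h \<otimes> commutator y h)" for z
  have step: "Q (commutator u v \<otimes> z)" if uv: "u \<in> H" "v \<in> H" and "Q z" for u v z
  proof -
    obtain a b y where ab: "a \<in> K" "b \<in> K" and y: "y \<in> carrier G" and zH: "z \<in> H"
      and z: "z = h \<otimes> commutator a b \<otimes> inv h \<otimes> commutator y h"
      using \<open>Q z\<close> unfolding Q_def by blast
    define a' where "a' = u \<otimes> (h \<otimes> a \<otimes> inv h)"
    define b' where "b' = v \<otimes> (h \<otimes> b \<otimes> inv h)"
    have K': "a' \<in> K" "b' \<in> K"
      using uv ab \<open>H \<subseteq> K\<close> conj by (auto simp: a'_def b'_def)
    have carr: "u \<in> carrier G" "v \<in> carrier G" "a \<in> carrier G" "b \<in> carrier G"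
      using uv ab by auto
    have eq: "commutator u v \<otimes> (h \<otimes> commutator a b \<otimes> inv h) = commutator a' b'"
      unfolding a'_def b'_def conj_commutator[OF carr(3,4) h]
      using carr h uv ab comm by (intro commutator_mult_distrib[symmetric]) auto
    have "commutator u v \<otimes> z \<in> H"
      using uv zH by simp
    moreover have "commutator u v \<otimes> z = h \<otimes> commutator a' b' \<otimes> inv h \<otimes>
        commutator (commutator u v \<otimes> z \<otimes> (h \<otimes> y \<otimes> inv h)) h"
      unfolding eq[symmetric]
    proof (rule mult_commutator_shift)
      show "commutator u v \<otimes> z \<otimes> (h \<otimes> (commutator u v \<otimes> (h \<otimes> commutator a b \<otimes> inv h)) \<otimes> inv h) =
          h \<otimes> (commutator u v \<otimes> (h \<otimes> commutator a b \<otimes> inv h)) \<otimes> inv h \<otimes> (commutator u v \<otimes> z)"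
        unfolding eq using uv zH K' by (intro comm) auto
    qed (use carr h y z in auto)
    moreover have "commutator u v \<otimes> z \<otimes> (h \<otimes> y \<otimes> inv h) \<in> carrier G"
      using carr h y H.mem_carrier[OF zH] by simp
    ultimately show ?thesis
      unfolding Q_def using K' by blast
  qed
  have "derived_set G H \<subseteq> carrier G"
    by auto
  note gen_carrier = generate_in_carrier[OF this]
  \<comment> \<open>\<open>step\<close> only prepends one commutator. Stating the claim for an
    arbitrary right factor \<open>z\<close> lets the case of a product of two generated elements
    follow by composition; \<open>z = \<one>\<close> gives the result.\<close>
  have "Q z \<longrightarrow> Q (x \<otimes> z)" for z
    using x
  proof (induction arbitrary: z)
    case one
    then show ?case by (auto simp: Q_def)
  next
    case (incl c)
    then show ?case using step by auto
  next
    case (inv c)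
    then show ?case using step by (auto simp: inv_commutator)
  next
    case (eng c d)
    have "c \<in> carrier G" "d \<in> carrier G"
      using eng.hyps gen_carrier by blast+
    moreover have "Q z \<Longrightarrow> z \<in> carrier G"
      by (auto simp: Q_def)
    ultimately show ?case using eng.IH by (metis m_assoc)
  qed
  moreover have "Q \<one>"
    unfolding Q_def using h by (auto intro!: bexI[of _ \<one>])
  ultimately have "Q (x \<otimes> \<one>)" by blast
  moreover have "x \<in> carrier G"
    using x by (rule gen_carrier)
  ultimately show ?thesis by (simp add: Q_def)
qed

text \<open>By the commutation hypothesis \<open>a\<close> may be replaced by \<open>commutator a k
  = (a \<otimes> k \<otimes> inv a) \<otimes> inv k\<close>. Its inverse, conjugated by
  \<open>b\<close>, supplies the other two factors.\<close>

lemma commutator_as_four_conjugates: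
  assumes "a \<in> carrier G" "b \<in> carrier G" "k \<in> carrier G"
    and "(k \<otimes> inv a \<otimes> inv k) \<otimes> b = b \<otimes> (k \<otimes> inv a \<otimes> inv k)"
  shows "commutator a b = (a \<otimes> k \<otimes> inv a) \<otimes> (inv k \<otimes>
    ((b \<otimes> k \<otimes> inv b) \<otimes> ((b \<otimes> a) \<otimes> inv k \<otimes> inv (b \<otimes> a))))"
proof -
  have "commutator a b = commutator (a \<otimes> (k \<otimes> inv a \<otimes> inv k)) b"
    using assms(1-3) by (intro commutator_mult_commuting[symmetric] assms(4)) auto
  also have "\<dots> = (a \<otimes> k \<otimes> inv a) \<otimes> (inv k \<otimes>
      ((b \<otimes> k \<otimes> inv b) \<otimes> ((b \<otimes> a) \<otimes> inv k \<otimes> inv (b \<otimes> a))))"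
    using assms(1-3) by (simp add: inv_mult_group m_assoc)
  finally show ?thesis .
qed

lemma conj_class_closed:
  assumes "c \<in> carrier G" "x \<in> conj_class G c \<union> m_inv G ` conj_class G c"
  shows "x \<in> carrier G" "inv x \<in> conj_class G c \<union> m_inv G ` conj_class G c"
    and "y \<in> carrier G \<Longrightarrow> y \<otimes> x \<otimes> inv y \<in> conj_class G c \<union> m_inv G ` conj_class G c"
proof -
  have conj: "y \<otimes> (z \<otimes> c \<otimes> inv z) \<otimes> inv y \<in> conj_class G c"
    if "y \<in> carrier G" "z \<in> carrier G" for y z
  proof -
    have "y \<otimes> (z \<otimes> c \<otimes> inv z) \<otimes> inv y = (y \<otimes> z) \<otimes> c \<otimes> inv (y \<otimes> z)"
      using assms(1) that by (simp add: inv_mult_group m_assoc)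
    then show ?thesis
      unfolding conj_class_def using that by blast
  qed
  obtain z where z: "z \<in> carrier G" and x: "x = z \<otimes> c \<otimes> inv z \<or> x = inv (z \<otimes> c \<otimes> inv z)"
    using assms(2) by (auto simp: conj_class_def)
  show "x \<in> carrier G"
    using assms(1) z x by auto
  have zc: "z \<otimes> c \<otimes> inv z \<in> conj_class G c"
    using z by (auto simp: conj_class_def)
  show "inv x \<in> conj_class G c \<union> m_inv G ` conj_class G c"
    using x
  proof
    assume "x = z \<otimes> c \<otimes> inv z"
    with zc show ?thesis by blast
  next
    assume "x = inv (z \<otimes> c \<otimes> inv z)"
    then have "inv x = z \<otimes> c \<otimes> inv z"
      using assms(1) z by (simp only: inv_inv m_closed inv_closed)
    with zc show ?thesis by simp
  qed
  assume y: "y \<in> carrier G"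
  have "y \<otimes> inv (z \<otimes> c \<otimes> inv z) \<otimes> inv y = inv (y \<otimes> (z \<otimes> c \<otimes> inv z) \<otimes> inv y)"
    using assms(1) y z by (simp add: inv_mult_group m_assoc)
  then show "y \<otimes> x \<otimes> inv y \<in> conj_class G c \<union> m_inv G ` conj_class G c"
    using x conj[OF y z] by (metis UnI1 UnI2 imageI)
qed

end

section \<open>The group of boundedly supported order automorphisms\<close>

lemma group_order_aut: "group (order_aut :: ('a::linorder \<Rightarrow> 'a) monoid)"
proof (rule groupI)
  fix f g :: "'a \<Rightarrow> 'a"
  assume "f \<in> carrier order_aut" "g \<in> carrier order_aut"
  then show "f \<otimes>\<^bsub>order_aut\<^esub> g \<in> carrier order_aut"
    by (simp add: order_aut_def bij_comp mono_def)
next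
  fix f :: "'a \<Rightarrow> 'a"
  assume "f \<in> carrier order_aut"
  then have f: "bij f" "mono f" by (simp_all add: order_aut_def)
  let ?g = "inv_into UNIV f"
  have fg: "f (?g x) = x" for x
    using f(1) by (simp add: bij_is_surj surj_f_inv_f)
  have "mono ?g"
  proof
    fix x y :: 'a
    assume "x \<le> y"
    show "?g x \<le> ?g y"
    proof (rule ccontr)
      assume *: "\<not> ?g x \<le> ?g y"
      then have "y \<le> x"
        using monoD[OF f(2), of "?g y" "?g x"] by (simp add: fg)
      with \<open>x \<le> y\<close> * show False by simp
    qed
  qed
  then show "\<exists>g\<in>carrier order_aut. g \<otimes>\<^bsub>order_aut\<^esub> f = \<one>\<^bsub>order_aut\<^esub>"
    using f(1) by (intro bexI[of _ ?g]) (simp_all add: order_aut_def bij_imp_bij_inv bij_is_inj)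
qed (simp_all add: order_aut_def comp_assoc mono_def)

lemma subgroup_boundedly_supported:
  "subgroup {g \<in> carrier order_aut. boundedly_supported g} (order_aut :: ('a::linorder \<Rightarrow> 'a) monoid)"
proof -
  interpret group "order_aut :: ('a \<Rightarrow> 'a) monoid" by (rule group_order_aut)
  show ?thesis
  proof (rule subgroupI)
    show "{g \<in> carrier (order_aut :: ('a \<Rightarrow> 'a) monoid). boundedly_supported g} \<noteq> {}"
      using one_closed by (auto simp: order_aut_def boundedly_supported_def)
  next
    fix f :: "'a \<Rightarrow> 'a"
    assume f: "f \<in> {g \<in> carrier order_aut. boundedly_supported g}"
    have "m_inv order_aut f (f x) = x" for x
      using l_inv[of f] f by (auto simp: order_aut_def fun_eq_iff)
    then have "m_inv order_aut f x \<noteq> x \<Longrightarrow> f x \<noteq> x" for x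
      by metis
    then show "m_inv order_aut f \<in> {g \<in> carrier order_aut. boundedly_supported g}"
      using f inv_closed[of f] unfolding boundedly_supported_def by blast
  next
    fix f g :: "'a \<Rightarrow> 'a"
    assume f: "f \<in> {g \<in> carrier order_aut. boundedly_supported g}"
      and g: "g \<in> {g \<in> carrier order_aut. boundedly_supported g}"
    obtain a b c d where ab: "\<forall>x. f x \<noteq> x \<longrightarrow> a < x \<and> x < b" and cd: "\<forall>x. g x \<noteq> x \<longrightarrow> c < x \<and> x < d"
      using f g by (auto simp: boundedly_supported_def)
    have "\<forall>x. f (g x) \<noteq> x \<longrightarrow> min a c < x \<and> x < max b d"
      unfolding min_less_iff_disj less_max_iff_disj using ab cd by metis
    then have "boundedly_supported (f \<otimes>\<^bsub>order_aut\<^esub> g)"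
      unfolding boundedly_supported_def by (auto simp: order_aut_def)
    then show "f \<otimes>\<^bsub>order_aut\<^esub> g \<in> {g \<in> carrier order_aut. boundedly_supported g}"
      using f g by auto
  qed auto
qed

lemma group_bounded_order_aut: "group (bounded_order_aut :: ('a::linorder \<Rightarrow> 'a) monoid)"
  unfolding bounded_order_aut_def
  using subgroup.subgroup_is_group[OF subgroup_boundedly_supported group_order_aut] .

section \<open>Subgroups of boundedly supported automorphisms: supports and displacement\<close>

locale bounded_order_group =
  fixes X :: "('a::linorder \<Rightarrow> 'a) set"
  assumes subgroup_X: "subgroup X bounded_order_aut"
begin

definition G :: "('a \<Rightarrow> 'a) monoid"
  where "G = bounded_order_aut \<lparr> carrier := X \<rparr>"

sublocale group G
  unfolding G_def using subgroup.subgroup_is_group[OF subgroup_X group_bounded_order_aut] .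

lemma carrier_G [simp]: "carrier G = X"
  by (simp add: G_def)

lemma mult_apply [simp]: "(f \<otimes>\<^bsub>G\<^esub> g) x = f (g x)"
  by (simp add: G_def bounded_order_aut_def order_aut_def)

lemma one_eq [simp]: "\<one>\<^bsub>G\<^esub> = id"
  by (simp add: G_def bounded_order_aut_def order_aut_def)

lemma mono_X: "f \<in> X \<Longrightarrow> mono f"
  using subgroup.subset[OF subgroup_X] by (auto simp: bounded_order_aut_def order_aut_def)

lemma inv_mem [simp]: "f \<in> X \<Longrightarrow> inv\<^bsub>G\<^esub> f \<in> X"
  using inv_closed[of f] by simp

lemma inv_apply [simp]:
  assumes "f \<in> X"
  shows "(inv\<^bsub>G\<^esub> f) (f x) = x" and "f ((inv\<^bsub>G\<^esub> f) x) = x"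
  using assms by (simp_all flip: mult_apply)

text \<open>The weak inequality, here and in \<open>fix_above\<close>, makes the bound itself a
  fixed point, so a monotone map in either set preserves both sides of it.\<close>

definition fix_below :: "'a \<Rightarrow> ('a \<Rightarrow> 'a) set"
  where "fix_below p = {g \<in> X. \<forall>x\<le>p. g x = x}"

definition fix_above :: "'a \<Rightarrow> ('a \<Rightarrow> 'a) set"
  where "fix_above q = {g \<in> X. \<forall>x\<ge>q. g x = x}"

lemma inv_fixed: "f \<in> X \<Longrightarrow> f x = x \<Longrightarrow> (inv\<^bsub>G\<^esub> f) x = x"
  by (metis inv_apply(1))

lemma mult_mem [simp]: "f \<in> X \<Longrightarrow> g \<in> X \<Longrightarrow> f \<otimes>\<^bsub>G\<^esub> g \<in> X"
  using m_closed[of f g] by simp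

lemma subgroup_fix_below: "subgroup (fix_below p) G"
  using one_closed by (intro subgroupI) (auto simp: fix_below_def inv_fixed )

lemma subgroup_fix_above: "subgroup (fix_above p) G"
  using one_closed by (intro subgroupI) (auto simp: fix_above_def inv_fixed)

lemma fix_below_mono: "p' \<le> p \<Longrightarrow> fix_below p \<subseteq> fix_below p'"
  by (auto simp: fix_below_def)

lemma exists_fix_below_above:
  assumes "f \<in> X"
  obtains p q where "f \<in> fix_below p" "f \<in> fix_above q"
proof -
  have "boundedly_supported f"
    using assms subgroup.subset[OF subgroup_X] by (auto simp: bounded_order_aut_def)
  then obtain a b where "\<forall>x. f x \<noteq> x \<longrightarrow> a < x \<and> x < b"
    by (auto simp: boundedly_supported_def)
  then have "f \<in> fix_below a" "f \<in> fix_above b"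
    using assms by (auto simp: fix_below_def fix_above_def not_le[symmetric])
  then show thesis using that by blast
qed

text \<open>The inverse of \<open>h\<close> is monotone and sends \<open>h p\<close> to
  \<open>p\<close>, hence sends every point up to \<open>p'\<close> into the region fixed by
  \<open>k\<close>.\<close>

lemma conj_fix_below:
  assumes "h \<in> X" "k \<in> fix_below p" and "p' \<le> h p"
  shows "h \<otimes>\<^bsub>G\<^esub> k \<otimes>\<^bsub>G\<^esub> inv\<^bsub>G\<^esub> h \<in> fix_below p'"
proof -
  have "(inv\<^bsub>G\<^esub> h) x \<le> p" if "x \<le> p'" for x
    using monoD[OF mono_X[of "inv\<^bsub>G\<^esub> h"], of x "h p"] assms that by simp
  then show ?thesis
    using assms by (auto simp: fix_below_def)
qed

text \<open>The supports lie on opposite sides of the common fixed point \<open>q\<close>. Both maps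
  preserve each side, and on each side one of them is the identity.\<close>

lemma fix_above_below_commute:
  assumes f: "f \<in> fix_above q" and g: "g \<in> fix_below q"
  shows "f \<otimes>\<^bsub>G\<^esub> g = g \<otimes>\<^bsub>G\<^esub> f"
proof
  fix x
  have X: "mono f" "mono g"
    using f g mono_X by (auto simp: fix_above_def fix_below_def)
  have fq: "f q = q" and gq: "g q = q"
    using f g by (auto simp: fix_above_def fix_below_def)
  have "f (g x) = g (f x)"
  proof (cases "x \<le> q")
    case True
    then have "f x \<le> q"
      using monoD[OF X(1), of x q] fq by simp
    with True g show ?thesis by (simp add: fix_below_def)
  next
    case False
    then have "q \<le> g x"
      using monoD[OF X(2), of q x] gq by simp
    with False f show ?thesis by (simp add: fix_above_def)
  qed
  then show "(f \<otimes>\<^bsub>G\<^esub> g) x = (g \<otimes>\<^bsub>G\<^esub> f) x" by simp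
qed

text \<open>Either \<open>c\<close> or its inverse moves some \<open>y\<close> up, to
  \<open>b y\<close>. Proximality gives \<open>g\<close> stretching the pair \<open>y\<close>,
  \<open>b y\<close> beyond \<open>p\<close> and \<open>q\<close>; the conjugate by \<open>g\<close>
  sends \<open>g y\<close>, which is below \<open>p\<close>, to \<open>g (b y)\<close>, which is
  above \<open>q\<close>.\<close>

lemma proximal_conjugate_displaces:
  assumes "proximal X" "c \<in> X" "c \<noteq> id"
  shows "\<exists>k \<in> conj_class G c \<union> m_inv G ` conj_class G c. q \<le> k p"
proof -
  let ?S = "conj_class G c \<union> m_inv G ` conj_class G c"
  obtain z where "c z \<noteq> z"
    using \<open>c \<noteq> id\<close> by (auto simp: fun_eq_iff)
  have "\<one>\<^bsub>G\<^esub> \<otimes>\<^bsub>G\<^esub> c \<otimes>\<^bsub>G\<^esub> inv\<^bsub>G\<^esub> \<one>\<^bsub>G\<^esub> \<in> ?S"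
    using one_closed by (auto simp: conj_class_def)
  then have "c \<in> ?S"
    using \<open>c \<in> X\<close> by (simp add: inv_one del: one_eq)
  obtain b y where b: "b \<in> ?S" and "y < b y"
  proof (cases "z < c z")
    case True
    with \<open>c \<in> ?S\<close> show thesis using that by blast
  next
    case False
    then have "c z < (inv\<^bsub>G\<^esub> c) (c z)"
      using \<open>c z \<noteq> z\<close> \<open>c \<in> X\<close> by simp
    with \<open>c \<in> ?S\<close> show thesis
      using that[of "inv\<^bsub>G\<^esub> c" "c z"] conj_class_closed(2)[of c c] \<open>c \<in> X\<close> by simp
  qed
  have "b \<in> X"
    using conj_class_closed(1)[of c b] b \<open>c \<in> X\<close> by simp
  \<comment> \<open>Proximality needs a proper target interval, but \<open>p\<close> and
    \<open>q\<close> come in any order. Enlarging by \<open>y\<close> and \<open>b y\<close> ensures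
    strictness.\<close>
  have "min p y < max q (b y)"
    using \<open>y < b y\<close> by (auto simp: min_less_iff_disj less_max_iff_disj)
  then obtain g where g: "g \<in> X" "g y < min p y" "max q (b y) < g (b y)"
    using \<open>proximal X\<close> \<open>y < b y\<close> unfolding proximal_def by metis
  define k where "k = g \<otimes>\<^bsub>G\<^esub> b \<otimes>\<^bsub>G\<^esub> inv\<^bsub>G\<^esub> g"
  have "k \<in> ?S"
    unfolding k_def using conj_class_closed(3)[of c b g] b g \<open>c \<in> X\<close> by simp
  have "k \<in> X"
    unfolding k_def using g \<open>b \<in> X\<close> by simp
  have "q \<le> k (g y)"
    using g by (simp add: k_def less_imp_le)
  also have "\<dots> \<le> k p"
    using monoD[OF mono_X[OF \<open>k \<in> X\<close>], of "g y" p] g by (simp add: less_imp_le)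
  finally show ?thesis using \<open>k \<in> ?S\<close> by blast
qed

lemma proximal_displaces:
  assumes "proximal X" "c \<in> X" "c \<noteq> id"
  shows "\<exists>k\<in>X. q \<le> k p"
proof -
  obtain k where "k \<in> conj_class G c \<union> m_inv G ` conj_class G c" "q \<le> k p"
    using proximal_conjugate_displaces[OF assms] by blast
  then show ?thesis
    using conj_class_closed(1)[of c k] assms(2) by auto
qed

section \<open>Products of commutators: two commutators and six conjugates\<close>

lemma derived_bounded:
  assumes "x \<in> derived G X"
  shows "\<exists>p q. x \<in> generate G (derived_set G (fix_below p \<inter> fix_above q))"
  using assms unfolding derived_def
proof induction
  case one
  show ?case by (blast intro: generate.one)
next
  have *: "\<exists>p q. c \<in> derived_set G (fix_below p \<inter> fix_above q)" if c: "c \<in> derived_set G X" for c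
  proof -
    obtain u v where uv: "u \<in> X" "v \<in> X" and "c = commutator u v"
      using c by auto
    obtain p q p' q' where "u \<in> fix_below p" "u \<in> fix_above q" "v \<in> fix_below p'" "v \<in> fix_above q'"
      using exists_fix_below_above uv by metis
    then have "u \<in> fix_below (min p p') \<inter> fix_above (max q q')" "v \<in> fix_below (min p p') \<inter> fix_above (max q q')"
      by (auto simp: fix_below_def fix_above_def)
    then show ?thesis using \<open>c = commutator u v\<close> by blast
  qed
  {
    case (incl c)
    then show ?case using *[OF incl] generate.incl by meson
  next
    case (inv c)
    then show ?case using *[OF inv] generate.inv by meson
  }
next
  case (eng c d)
  then obtain p q p' q' where cd: "c \<in> generate G (derived_set G (fix_below p \<inter> fix_above q))"
    "d \<in> generate G (derived_set G (fix_below p' \<inter> fix_above q'))" by blast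
  \<comment> \<open>Enlarging both bounds puts the two factors into the derived subgroup of one
    common group with bounded support.\<close>
  let ?H = "fix_below (min p p') \<inter> fix_above (max q q')"
  have H: "fix_below p \<inter> fix_above q \<subseteq> ?H" "fix_below p' \<inter> fix_above q' \<subseteq> ?H"
    by (auto simp: fix_below_def fix_above_def)
  have "c \<in> generate G (derived_set G ?H)"
    using cd(1) by (rule mono_generate[OF mono_derived_set[OF H(1)], THEN subsetD])
  moreover have "d \<in> generate G (derived_set G ?H)"
    using cd(2) by (rule mono_generate[OF mono_derived_set[OF H(2)], THEN subsetD])
  ultimately show ?case by (intro exI generate.eng)
qed

text \<open>Displacement is applied with the two-sided group
  \<open>fix_below p \<inter> fix_above q\<close> as \<open>H\<close> and the one-sided
  \<open>fix_below p\<close> as \<open>K\<close>. Leaving \<open>K\<close> without a common upper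
  bound is what allows conjugation by \<open>h\<close> to map it into itself.\<close>

lemma derived_decomposition:
  assumes "proximal X" "x \<in> derived G X" "c \<in> X" "c \<noteq> id"
  obtains h a b y where "h \<in> conj_class G c \<union> m_inv G ` conj_class G c"
    and "a \<in> X" "b \<in> X" "y \<in> X" and "x = commutator a b \<otimes>\<^bsub>G\<^esub> commutator y h"
proof -
  let ?S = "conj_class G c \<union> m_inv G ` conj_class G c"
  obtain p q where x: "x \<in> generate G (derived_set G (fix_below p \<inter> fix_above q))"
    using derived_bounded[OF assms(2)] by blast
  \<comment> \<open>The bound \<open>p \<le> h p\<close> keeps conjugates inside \<open>K\<close>,
    and \<open>q \<le> h p\<close> moves them off the supports of elements of
    \<open>H\<close>.\<close>
  obtain h where h: "h \<in> ?S" and hp: "max p q \<le> h p"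
    using proximal_conjugate_displaces[OF assms(1,3,4)] by blast
  have hX: "h \<in> X"
    using conj_class_closed(1)[of c h] h \<open>c \<in> X\<close> by simp
  have conj: "h \<otimes>\<^bsub>G\<^esub> k \<otimes>\<^bsub>G\<^esub> inv\<^bsub>G\<^esub> h \<in> fix_below (max p q)" if "k \<in> fix_below p" for k
    using conj_fix_below[OF hX that hp] .
  have "\<exists>a\<in>fix_below p. \<exists>b\<in>fix_below p. \<exists>y\<in>carrier G.
      x = h \<otimes>\<^bsub>G\<^esub> commutator a b \<otimes>\<^bsub>G\<^esub> inv\<^bsub>G\<^esub> h \<otimes>\<^bsub>G\<^esub> commutator y h"
  proof (rule displaced_generate_derived_set[OF _ subgroup_fix_below _ _ _ _ x])
    show "subgroup (fix_below p \<inter> fix_above q) G"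
      by (rule subgroups_Inter_pair[OF subgroup_fix_below subgroup_fix_above])
    show "h \<otimes>\<^bsub>G\<^esub> k \<otimes>\<^bsub>G\<^esub> inv\<^bsub>G\<^esub> h \<in> fix_below p" if "k \<in> fix_below p" for k
      using conj[OF that] fix_below_mono[of p "max p q"] by auto
    show "f \<otimes>\<^bsub>G\<^esub> (h \<otimes>\<^bsub>G\<^esub> k \<otimes>\<^bsub>G\<^esub> inv\<^bsub>G\<^esub> h) = h \<otimes>\<^bsub>G\<^esub> k \<otimes>\<^bsub>G\<^esub> inv\<^bsub>G\<^esub> h \<otimes>\<^bsub>G\<^esub> f"
      if "f \<in> fix_below p \<inter> fix_above q" "k \<in> fix_below p" for f k
      using that(1) conj[OF that(2)] fix_below_mono[of q "max p q"]
      by (intro fix_above_below_commute[of _ q]) auto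
  qed (use hX in auto)
  then obtain a b y where aby: "a \<in> X" "b \<in> X" "y \<in> X"
    and x: "x = h \<otimes>\<^bsub>G\<^esub> commutator a b \<otimes>\<^bsub>G\<^esub> inv\<^bsub>G\<^esub> h \<otimes>\<^bsub>G\<^esub> commutator y h"
    by (auto simp: fix_below_def)
  have "h \<otimes>\<^bsub>G\<^esub> commutator a b \<otimes>\<^bsub>G\<^esub> inv\<^bsub>G\<^esub> h =
      commutator (h \<otimes>\<^bsub>G\<^esub> a \<otimes>\<^bsub>G\<^esub> inv\<^bsub>G\<^esub> h) (h \<otimes>\<^bsub>G\<^esub> b \<otimes>\<^bsub>G\<^esub> inv\<^bsub>G\<^esub> h)"
    using aby hX by (intro conj_commutator) auto
  with x show thesis
    using that[OF h _ _ aby(3), of "h \<otimes>\<^bsub>G\<^esub> a \<otimes>\<^bsub>G\<^esub> inv\<^bsub>G\<^esub> h" "h \<otimes>\<^bsub>G\<^esub> b \<otimes>\<^bsub>G\<^esub> inv\<^bsub>G\<^esub> h"] aby hX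
    by simp
qed

text \<open>\<open>k\<close> pushes the support of the inverse of \<open>u\<close> above that of
  \<open>v\<close>. The set \<open>S\<close> is left open: it is a conjugacy class with its inverses
  when conjugates are counted, and all of \<open>X\<close> in the proof of perfectness.\<close>

lemma exists_displaced_inverse_commutes:
  assumes "u \<in> X" "v \<in> X"
    and "\<And>p q. \<exists>k\<in>S. k \<in> X \<and> q \<le> k p"
  shows "\<exists>k\<in>S. k \<in> X \<and>
    (k \<otimes>\<^bsub>G\<^esub> inv\<^bsub>G\<^esub> u \<otimes>\<^bsub>G\<^esub> inv\<^bsub>G\<^esub> k) \<otimes>\<^bsub>G\<^esub> v = v \<otimes>\<^bsub>G\<^esub> (k \<otimes>\<^bsub>G\<^esub> inv\<^bsub>G\<^esub> u \<otimes>\<^bsub>G\<^esub> inv\<^bsub>G\<^esub> k)"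
proof -
  obtain p where p: "inv\<^bsub>G\<^esub> u \<in> fix_below p"
    using exists_fix_below_above[of "inv\<^bsub>G\<^esub> u"] \<open>u \<in> X\<close> by auto
  obtain q where q: "v \<in> fix_above q"
    using exists_fix_below_above[of v] \<open>v \<in> X\<close> by auto
  obtain k where "k \<in> S" "k \<in> X" "q \<le> k p"
    using assms(3) by blast
  then show ?thesis
    using fix_above_below_commute[OF q conj_fix_below[OF _ p, of k q]] by auto
qed

lemma derived_product_of_six_conjugates:
  assumes "proximal X" "x \<in> derived G X" "c \<in> X" "c \<noteq> id"
  shows "is_product G (conj_class G c \<union> m_inv G ` conj_class G c) 6 x"
proof -
  let ?S = "conj_class G c \<union> m_inv G ` conj_class G c"
  have cG: "c \<in> carrier G"
    using \<open>c \<in> X\<close> by simp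
  obtain h a b y where h: "h \<in> ?S" and aby: "a \<in> X" "b \<in> X" "y \<in> X"
    and x: "x = commutator a b \<otimes>\<^bsub>G\<^esub> commutator y h"
    using derived_decomposition[OF assms] .
  have "\<exists>k\<in>?S. k \<in> X \<and> q \<le> k p" for p q
    using proximal_conjugate_displaces[OF assms(1,3,4), of q p] conj_class_closed(1)[OF cG] by auto
  then obtain k where k: "k \<in> ?S"
    and comm: "(k \<otimes>\<^bsub>G\<^esub> inv\<^bsub>G\<^esub> a \<otimes>\<^bsub>G\<^esub> inv\<^bsub>G\<^esub> k) \<otimes>\<^bsub>G\<^esub> b = b \<otimes>\<^bsub>G\<^esub> (k \<otimes>\<^bsub>G\<^esub> inv\<^bsub>G\<^esub> a \<otimes>\<^bsub>G\<^esub> inv\<^bsub>G\<^esub> k)"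
    using exists_displaced_inverse_commutes[OF aby(1,2), of ?S] by blast
  have carr: "a \<in> carrier G" "b \<in> carrier G" "y \<in> carrier G" "h \<in> carrier G" "k \<in> carrier G"
    using aby conj_class_closed(1)[OF cG] h k by auto
  \<comment> \<open>The first four entries multiply to \<open>commutator a b\<close>, the last two
    to \<open>commutator y h\<close>.\<close>
  let ?xs = "[a \<otimes>\<^bsub>G\<^esub> k \<otimes>\<^bsub>G\<^esub> inv\<^bsub>G\<^esub> a, inv\<^bsub>G\<^esub> k, b \<otimes>\<^bsub>G\<^esub> k \<otimes>\<^bsub>G\<^esub> inv\<^bsub>G\<^esub> b,
    (b \<otimes>\<^bsub>G\<^esub> a) \<otimes>\<^bsub>G\<^esub> inv\<^bsub>G\<^esub> k \<otimes>\<^bsub>G\<^esub> inv\<^bsub>G\<^esub> (b \<otimes>\<^bsub>G\<^esub> a), y \<otimes>\<^bsub>G\<^esub> h \<otimes>\<^bsub>G\<^esub> inv\<^bsub>G\<^esub> y, inv\<^bsub>G\<^esub> h]"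
  note closed = conj_class_closed(2,3)[OF cG]
  have "set ?xs \<subseteq> ?S"
    using closed(1)[OF k] closed(1)[OF h] closed(2)[OF k] closed(2)[OF h]
      closed(2)[OF closed(1)[OF k]] carr m_closed[of b a]
    by (simp only: list.set insert_subset empty_subsetI simp_thms)
  moreover have "foldr (\<otimes>\<^bsub>G\<^esub>) ?xs \<one>\<^bsub>G\<^esub> = x"
    unfolding x commutator_as_four_conjugates[OF carr(1,2,5) comm]
    using carr by (simp add: m_assoc del: one_eq carrier_G)
  moreover have "length ?xs = 6"
    by simp
  ultimately show ?thesis
    unfolding is_product_def by blast
qed

lemma commutator_width_le_2:
  assumes "proximal X"
  shows "commutator_width G \<le> 2"
  unfolding commutator_width_def
proof (rule SUP_least)
  fix x
  assume x: "x \<in> derived G (carrier G)"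
  then have xD: "x \<in> derived G X" by simp
  obtain a b c d where abcd: "a \<in> X" "b \<in> X" "c \<in> X" "d \<in> X"
    and eq: "x = commutator a b \<otimes>\<^bsub>G\<^esub> commutator c d"
  proof (cases "\<exists>c\<in>X. c \<noteq> id")
    case True
    then obtain c where c: "c \<in> X" "c \<noteq> id" by blast
    obtain h a b y where "h \<in> conj_class G c \<union> m_inv G ` conj_class G c"
      "a \<in> X" "b \<in> X" "y \<in> X" "x = commutator a b \<otimes>\<^bsub>G\<^esub> commutator y h"
      using derived_decomposition[OF assms xD c] .
    then show thesis
      using that[of a b y h] conj_class_closed(1)[of c h] c by simp
  next
    \<comment> \<open>The decomposition requires a nontrivial \<open>c\<close>. In the trivial group
      \<open>x\<close> is the identity, written as a product of two trivial commutators.\<close>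
    case False
    have "x \<in> carrier G"
      using derived_in_carrier[of X] xD by auto
    then have "x = \<one>\<^bsub>G\<^esub>"
      using False by auto
    then show thesis
      using that[of "\<one>\<^bsub>G\<^esub>" "\<one>\<^bsub>G\<^esub>" "\<one>\<^bsub>G\<^esub>" "\<one>\<^bsub>G\<^esub>"] one_closed by (simp del: one_eq)
  qed
  have carr: "a \<in> carrier G" "b \<in> carrier G" "c \<in> carrier G" "d \<in> carrier G"
    using abcd by simp_all
  have "foldr (\<otimes>\<^bsub>G\<^esub>) [commutator a b, commutator c d] \<one>\<^bsub>G\<^esub> = x"
    unfolding eq using carr by (simp del: one_eq carrier_G)
  moreover have "set [commutator a b, commutator c d] \<subseteq> derived_set G (carrier G)"
    using carr by auto
  ultimately have "is_product G (derived_set G (carrier G)) 2 x"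
    unfolding is_product_def by (intro exI[of _ "[commutator a b, commutator c d]"]) simp
  then have "commutator_length G x \<le> enat 2"
    unfolding commutator_length_def by (intro INF_lower) simp
  then show "commutator_length G x \<le> 2"
    by (simp add: numeral_eq_enat)
qed

text \<open>Perfectness extends the six-conjugate bound from the derived subgroup to the whole
  group, while the conjugating elements still come from that same group.\<close>

lemma uniformly_simple_6:
  assumes "proximal X" "derived G X = X"
  shows "uniformly_simple 6 G"
  unfolding uniformly_simple_def
  using group_axioms derived_product_of_six_conjugates[OF assms(1)] assms(2) by fastforce

section \<open>The commutator subgroup of a proximal group is proximal and perfect\<close>

lemma subgroup_derived: "subgroup (derived G X) bounded_order_aut"
proof -
  have "subgroup (derived G X) G"
    using derived_is_subgroup[of X] by simp
  then show ?thesis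
    unfolding G_def
    by (rule group.incl_subgroup[OF group_bounded_order_aut subgroup_X])
qed

lemma commutator_in_derived: "u \<in> X \<Longrightarrow> v \<in> X \<Longrightarrow> commutator u v \<in> derived G X"
  unfolding derived_def by (blast intro: generate.incl)

text \<open>A proximality witness \<open>s\<close> is replaced by \<open>commutator s t\<close>,
  where \<open>t\<close> conjugates the inverse of \<open>s\<close> to a map fixing all points up to
  \<open>b\<close>; the two agree at \<open>a\<close> and at \<open>b\<close>.\<close>

lemma proximal_derived:
  assumes "proximal X"
  shows "proximal (derived G X)"
  unfolding proximal_def
proof (intro allI impI)
  fix a b c d :: 'a
  assume "a < b" "c < d"
  then obtain s where s: "s \<in> X" "s a < c" "d < s b"
    using assms unfolding proximal_def by blast
  show "\<exists>g\<in>derived G X. g a < c \<and> c < d \<and> d < g b"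
  proof (cases "s = id")
    \<comment> \<open>Displacement starts from a nontrivial element, so \<open>s = id\<close> is
      treated apart; the identity already lies in the derived subgroup.\<close>
    case True
    then have "s \<in> derived G X"
      using generate.one[of G] by (simp add: derived_def)
    then show ?thesis
      using s \<open>c < d\<close> by blast
  next
    case False
    obtain p where p: "inv\<^bsub>G\<^esub> s \<in> fix_below p"
      using exists_fix_below_above[of "inv\<^bsub>G\<^esub> s"] \<open>s \<in> X\<close> by auto
    obtain t where t: "t \<in> X" "b \<le> t p"
      using proximal_displaces[OF assms \<open>s \<in> X\<close> False] by blast
    have "t \<otimes>\<^bsub>G\<^esub> inv\<^bsub>G\<^esub> s \<otimes>\<^bsub>G\<^esub> inv\<^bsub>G\<^esub> t \<in> fix_below b"
      using conj_fix_below[OF t(1) p t(2)] .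
    then have "t ((inv\<^bsub>G\<^esub> s) ((inv\<^bsub>G\<^esub> t) z)) = z" if "z \<le> b" for z
      using that by (simp add: fix_below_def)
    then have "commutator s t a = s a" "commutator s t b = s b"
      using \<open>a < b\<close> by simp_all
    then show ?thesis
      using s \<open>c < d\<close> t commutator_in_derived[of s t] by (intro bexI[of _ "commutator s t"]) simp_all
  qed
qed

text \<open>The element \<open>w\<close> is \<open>commutator u k\<close> for a \<open>k\<close>
  that makes the conjugate of the inverse of \<open>u\<close> commute with \<open>v\<close>.\<close>

lemma commutator_eq_commutator_derived:
  assumes "proximal X" "u \<in> X" "v \<in> X"
  shows "\<exists>w\<in>derived G X. commutator u v = commutator w v"
proof (cases "u = id")
  case True
  then show ?thesis
    using generate.one[of G] by (auto simp: derived_def)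
next
  case False
  obtain k where k: "k \<in> X"
    and "(k \<otimes>\<^bsub>G\<^esub> inv\<^bsub>G\<^esub> u \<otimes>\<^bsub>G\<^esub> inv\<^bsub>G\<^esub> k) \<otimes>\<^bsub>G\<^esub> v = v \<otimes>\<^bsub>G\<^esub> (k \<otimes>\<^bsub>G\<^esub> inv\<^bsub>G\<^esub> u \<otimes>\<^bsub>G\<^esub> inv\<^bsub>G\<^esub> k)"
    using exists_displaced_inverse_commutes[OF assms(2,3), of X]
      proximal_displaces[OF assms(1,2) False] by blast
  then have "commutator (u \<otimes>\<^bsub>G\<^esub> (k \<otimes>\<^bsub>G\<^esub> inv\<^bsub>G\<^esub> u \<otimes>\<^bsub>G\<^esub> inv\<^bsub>G\<^esub> k)) v = commutator u v"
    using assms k by (intro commutator_mult_commuting) simp_all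
  moreover have "u \<otimes>\<^bsub>G\<^esub> (k \<otimes>\<^bsub>G\<^esub> inv\<^bsub>G\<^esub> u \<otimes>\<^bsub>G\<^esub> inv\<^bsub>G\<^esub> k) = commutator u k"
    using assms k by (simp add: m_assoc)
  ultimately show ?thesis
    using commutator_in_derived[of u k] assms k by metis
qed

lemma derived_set_derived:
  assumes "proximal X"
  shows "derived_set G X \<subseteq> derived_set G (derived G X)"
proof
  fix x
  assume "x \<in> derived_set G X"
  then obtain u v where uv: "u \<in> X" "v \<in> X" and x: "x = commutator u v" by auto
  have D: "w \<in> X" if "w \<in> derived G X" for w
    using derived_in_carrier[of X] that by auto
  obtain w where w: "w \<in> derived G X" "commutator u v = commutator w v"
    using commutator_eq_commutator_derived[OF assms uv] by blast
  \<comment> \<open>Only first entries can be replaced, so the second entry is reached by inverting,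
    which swaps the two.\<close>
  obtain w' where w': "w' \<in> derived G X" "commutator v w = commutator w' w"
    using commutator_eq_commutator_derived[OF assms uv(2) D[OF w(1)]] by blast
  have "x = inv\<^bsub>G\<^esub> (commutator v w)"
    using D[OF w(1)] uv by (simp add: x w inv_commutator)
  also have "\<dots> = commutator w w'"
    using D[OF w(1)] D[OF w'(1)] by (simp add: w' inv_commutator)
  finally show "x \<in> derived_set G (derived G X)"
    using w w' by blast
qed

end

theorem theorem1p1:
  fixes \<Gamma> :: "('a::linorder \<Rightarrow> 'a) set"
  assumes "subgroup \<Gamma> bounded_order_aut"
    and "proximal \<Gamma>"
  shows "uniformly_simple 6 (commutator_subgroup (bounded_order_aut \<lparr> carrier := \<Gamma> \<rparr>)) \<and>
    commutator_width (commutator_subgroup (bounded_order_aut \<lparr> carrier := \<Gamma> \<rparr>)) \<le> 2"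
proof -
  interpret \<Gamma>: bounded_order_group \<Gamma>
    by (rule bounded_order_group.intro[OF assms(1)])
  define D where "D = derived \<Gamma>.G \<Gamma>"
  have sub: "subgroup D bounded_order_aut"
    unfolding D_def by (rule \<Gamma>.subgroup_derived)
  \<comment> \<open>A second instance of the locale, now for the commutator subgroup: the bounds are
    proved for a group and applied here to \<open>D\<close>.\<close>
  interpret D: bounded_order_group D
    by (rule bounded_order_group.intro[OF sub])
  have D: "D.G = commutator_subgroup (bounded_order_aut \<lparr> carrier := \<Gamma> \<rparr>)"
    unfolding D.G_def commutator_subgroup_def by (simp add: D_def \<Gamma>.G_def)
  have prox: "proximal D"
    unfolding D_def using \<Gamma>.proximal_derived[OF assms(2)] .
  have "subgroup D \<Gamma>.G"
    unfolding D_def using \<Gamma>.derived_is_subgroup[of \<Gamma>] by simp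
  moreover have DG: "D.G = \<Gamma>.G \<lparr> carrier := D \<rparr>"
    unfolding D.G_def \<Gamma>.G_def by simp
  \<comment> \<open>Perfectness of \<open>D\<close> concerns the derived subgroup formed inside
    \<open>D.G\<close>, whereas \<open>derived_set_derived\<close> speaks of the operations of
    \<open>\<Gamma>.G\<close>; the two agree on the subgroup \<open>D\<close>.\<close>
  ultimately have "derived D.G D = derived \<Gamma>.G D"
    using \<Gamma>.derived_consistent[of D D] by simp
  also have "D \<subseteq> derived \<Gamma>.G D"
    using \<Gamma>.mono_generate[OF \<Gamma>.derived_set_derived[OF assms(2)]]
    by (simp add: D_def derived_def)
  finally have "D \<subseteq> derived D.G D" .
  moreover have "derived D.G D \<subseteq> D"
    using D.derived_in_carrier[of D] by simp
  ultimately have "derived D.G D = D" by simp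
  then show ?thesis
    using D.uniformly_simple_6[OF prox] D.commutator_width_le_2[OF prox] by (simp add: D)
qed

end
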